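(* Let $G$ be a connected graph of order $n_1$, and let $H$ be a graph of order $n_2$ and maximum degree $\Delta$. (i) If $\Delta=n_2-1$, then $\dim_s(K_1+H)=n_2+1-\varpi(H)$. (ii) If $\Delta\le n_2-2$ or $n_1\ge 2$, then $\dim_s(G\odot H)=n_1n_2-\varpi(H)$.
   Context: All graphs are finite and simple. $K_1$ is the one-vertex graph; the join $A+B$ is obtained from disjoint $A$, $B$ by joining every vertex of $A$ to every vertex of $B$. For $G$ with vertices $v_1,\dots,v_{n_1}$, the corona product $G\odot H$ is obtained from $G$ and $n_1$ disjoint copies $H_1,\dots,H_{n_1}$ of $H$ by joining $v_i$ to every vertex of $H_i$. For a connected graph $X$, $I_X[u,v]$ is the set of vertices on some shortest $u$–$v$ path; $w$ strongly resolves $u,v$ if $v\in I_X[u,w]$ or $u\in I_X[v,w]$; a strong resolving set is a set $S$ such that every two distinct vertices are strongly resolved by some vertex of $S$; $\dim_s(X)$ is the minimum size of a strong resolving set. True twins are distinct vertices with equal closed neighborhoods; a twin-free clique is a clique containing no two true twins; $\varpi(H)$ is the maximum size of a twin-free clique of $H$. *)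

theory Defs
  imports "Graph_Theory.Digraph_Component"
begin

text \<open>
  A finite simple graph is a \<^locale>\<open>pair_graph\<close>: a finite, loop-free digraph with a symmetric
  arc relation. An edge is thus a pair of opposite arcs, and the degree of a vertex is its
  \<^const>\<open>out_degree\<close>.
\<close>

definition K1 :: "unit pair_pre_digraph" where
  "K1 = \<lparr> pverts = {()}, parcs = {} \<rparr>"

definition graph_join ::
  "'a pair_pre_digraph \<Rightarrow> 'b pair_pre_digraph \<Rightarrow> ('a + 'b) pair_pre_digraph" where
  "graph_join A B = \<lparr>
     pverts = pverts A <+> pverts B,
     parcs = {(Inl u, Inl v) | u v. (u, v) \<in> parcs A}
           \<union> {(Inr x, Inr y) | x y. (x, y) \<in> parcs B}
           \<union> {(Inl u, Inr x) | u x. u \<in> pverts A \<and> x \<in> pverts B}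
           \<union> {(Inr x, Inl u) | u x. u \<in> pverts A \<and> x \<in> pverts B} \<rparr>"

text \<open>The vertex \<open>Inr (v, x)\<close> of the corona is the vertex \<open>x\<close> in the copy of \<open>H\<close> attached to \<open>v\<close>.\<close>

definition corona ::
  "'a pair_pre_digraph \<Rightarrow> 'b pair_pre_digraph \<Rightarrow> ('a + 'a \<times> 'b) pair_pre_digraph" where
  "corona G H = \<lparr>
     pverts = pverts G <+> (pverts G \<times> pverts H),
     parcs = {(Inl u, Inl v) | u v. (u, v) \<in> parcs G}
           \<union> {(Inr (v, x), Inr (v, y)) | v x y. v \<in> pverts G \<and> (x, y) \<in> parcs H}
           \<union> {(Inl v, Inr (v, x)) | v x. v \<in> pverts G \<and> x \<in> pverts H}
           \<union> {(Inr (v, x), Inl v) | v x. v \<in> pverts G \<and> x \<in> pverts H} \<rparr>"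

definition max_degree :: "'a pair_pre_digraph \<Rightarrow> nat" where
  "max_degree G = Max (out_degree (with_proj G) ` pverts G)"

definition shortest_path ::
  "'a pair_pre_digraph \<Rightarrow> 'a \<Rightarrow> ('a \<times> 'a) awalk \<Rightarrow> 'a \<Rightarrow> bool" where
  "shortest_path X u p v \<longleftrightarrow>
     pre_digraph.apath (with_proj X) u p v \<and>
     (\<forall>q. pre_digraph.apath (with_proj X) u q v \<longrightarrow> length p \<le> length q)"

definition geodesic_interval :: "'a pair_pre_digraph \<Rightarrow> 'a \<Rightarrow> 'a \<Rightarrow> 'a set" where
  "geodesic_interval X u v = {w. \<exists>p. shortest_path X u p v \<and> w \<in> set (pawalk_verts u p)}"

definition strongly_resolves :: "'a pair_pre_digraph \<Rightarrow> 'a \<Rightarrow> 'a \<Rightarrow> 'a \<Rightarrow> bool" where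
  "strongly_resolves X w u v \<longleftrightarrow>
     v \<in> geodesic_interval X u w \<or> u \<in> geodesic_interval X v w"

definition strong_resolving_set :: "'a pair_pre_digraph \<Rightarrow> 'a set \<Rightarrow> bool" where
  "strong_resolving_set X S \<longleftrightarrow>
     S \<subseteq> pverts X \<and>
     (\<forall>u \<in> pverts X. \<forall>v \<in> pverts X. u \<noteq> v \<longrightarrow> (\<exists>w \<in> S. strongly_resolves X w u v))"

definition strong_metric_dim :: "'a pair_pre_digraph \<Rightarrow> nat" where
  "strong_metric_dim X = Min (card ` {S. strong_resolving_set X S})"

definition closed_nbhd :: "'a pair_pre_digraph \<Rightarrow> 'a \<Rightarrow> 'a set" where
  "closed_nbhd X v = insert v {u. (v, u) \<in> parcs X}"

definition true_twins :: "'a pair_pre_digraph \<Rightarrow> 'a \<Rightarrow> 'a \<Rightarrow> bool" where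
  "true_twins X u v \<longleftrightarrow>
     u \<in> pverts X \<and> v \<in> pverts X \<and> u \<noteq> v \<and> closed_nbhd X u = closed_nbhd X v"

definition clique :: "'a pair_pre_digraph \<Rightarrow> 'a set \<Rightarrow> bool" where
  "clique X C \<longleftrightarrow> C \<subseteq> pverts X \<and> (\<forall>u \<in> C. \<forall>v \<in> C. u \<noteq> v \<longrightarrow> (u, v) \<in> parcs X)"

definition twin_free_clique :: "'a pair_pre_digraph \<Rightarrow> 'a set \<Rightarrow> bool" where
  "twin_free_clique X C \<longleftrightarrow> clique X C \<and> \<not> (\<exists>u \<in> C. \<exists>v \<in> C. true_twins X u v)"

definition twin_free_clique_number :: "'a pair_pre_digraph \<Rightarrow> nat" where
  "twin_free_clique_number X = Max (card ` {C. twin_free_clique X C})"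

lemma pair_graph_K1: "pair_graph K1"
  by unfold_locales (auto simp: K1_def symmetric_def sym_def)

lemma pair_graph_join:
  assumes "pair_graph A" and "pair_graph B"
  shows "pair_graph (graph_join A B)"
proof -
  interpret A: pair_graph A by fact
  interpret B: pair_graph B by fact
  let ?J = "graph_join A B"
  have wf: "parcs ?J \<subseteq> pverts ?J \<times> pverts ?J"
    by (auto simp: graph_join_def dest: A.wellformed' B.wellformed')
  have fin: "finite (pverts ?J)"
    by (simp add: graph_join_def A.pair_finite_verts B.pair_finite_verts)
  show ?thesis
  proof unfold_locales
    show "finite (parcs ?J)" using wf fin by (meson finite_SigmaI finite_subset)
    show "symmetric (with_proj ?J)"
      unfolding symmetric_def with_proj_simps
      by (rule symI) (auto simp: graph_join_def dest: A.arcs_symmetric B.arcs_symmetric)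
  qed (use fin in \<open>auto simp: graph_join_def dest: A.no_loops' B.no_loops' A.wellformed' B.wellformed'\<close>)
qed

lemma pair_graph_corona:
  assumes "pair_graph G" and "pair_graph H"
  shows "pair_graph (corona G H)"
proof -
  interpret G: pair_graph G by fact
  interpret H: pair_graph H by fact
  let ?C = "corona G H"
  have wf: "parcs ?C \<subseteq> pverts ?C \<times> pverts ?C"
    by (auto simp: corona_def dest: G.wellformed' H.wellformed')
  have fin: "finite (pverts ?C)"
    by (simp add: corona_def G.pair_finite_verts H.pair_finite_verts)
  show ?thesis
  proof unfold_locales
    show "finite (parcs ?C)" using wf fin by (meson finite_SigmaI finite_subset)
    show "symmetric (with_proj ?C)"
      unfolding symmetric_def with_proj_simps
      by (rule symI) (auto simp: corona_def dest: G.arcs_symmetric H.arcs_symmetric)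
  qed (use fin in \<open>auto simp: corona_def dest: G.no_loops' H.no_loops' G.wellformed' H.wellformed'\<close>)
qed

end

theory Submission
  imports Defs
begin

text \<open>
  In a graph of diameter at most two, an interior vertex of a geodesic is the middle vertex of two
  non-adjacent vertices. Hence a vertex outside \<open>{u, v}\<close> strongly resolves \<open>u\<close> and \<open>v\<close> precisely
  when \<open>u\<close> and \<open>v\<close> are adjacent and it is adjacent to only one of them, and the strong resolving sets
  are exactly the complements of twin-free cliques.

  In a corona, a geodesic can pass through a vertex of a copy of \<open>H\<close> only if it has length two and
  stays in that copy, because the attaching vertex dominates the copy and separates it from the rest.
  So the copy vertices missed by a strong resolving set lie in one copy and form a twin-free clique
  there. Conversely, let \<open>S\<close> be the set of copy vertices outside such a clique in the copy at \<open>v\<close>.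
  Clique vertices are distinguished as above, and a pair involving \<open>u \<in> G\<close> is resolved from inside the
  copy at \<open>u\<close>, unless \<open>u = v\<close> and the other vertex is in the clique. In that case one uses another
  copy or, if \<open>G\<close> is a single vertex, a non-neighbour of the clique vertex in the same copy.
\<close>

section \<open>Geodesic intervals via relation powers\<close>

context pair_wf_digraph
begin

lemma awalk_imp_relpow: "awalk u p v \<Longrightarrow> (u, v) \<in> parcs G ^^ length p"
proof (induction p arbitrary: u)
  case (Cons e p)
  then have "(u, snd e) \<in> parcs G" and "awalk (snd e) p v"
    by (auto simp: awalk_Cons_iff)
  then have "(u, v) \<in> parcs G ^^ Suc (length p)"
    using Cons.IH by (blast intro: relpow_Suc_I2)
  then show ?case by simp
qed (simp add: awalk_Nil_iff)

lemma relpow_imp_awalk: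
  assumes "u \<in> pverts G" and "(u, v) \<in> parcs G ^^ n"
  shows "\<exists>p. awalk u p v \<and> length p = n"
  using assms
proof (induction n arbitrary: u)
  case (Suc n)
  then obtain w where w: "(u, w) \<in> parcs G" "(w, v) \<in> parcs G ^^ n"
    by (meson relpow_Suc_E2)
  with Suc.IH obtain p where "awalk w p v" "length p = n"
    using wellformed'(2) by blast
  with w show ?case
    by (intro exI[of _ "(u, w) # p"]) (simp add: awalk_Cons_iff)
qed (auto simp: awalk_Nil_iff)

text \<open>A repeated vertex would cut out a nonempty closed walk \<open>r\<close>, and deleting it
  would leave a shorter walk with the same ends.\<close>

lemma minimal_awalk_imp_apath:
  assumes "awalk u p v" and "\<And>q. awalk u q v \<Longrightarrow> length p \<le> length q"
  shows "apath u p v"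
proof (rule ccontr)
  assume "\<not> apath u p v"
  then have "\<not> distinct (awalk_verts u p)"
    using assms(1) by (simp add: apath_def)
  then obtain q r s where qrs: "p = q @ r @ s"
      "\<exists>w. awalk u q w \<and> awalk w r w \<and> awalk w s v" "closed_w r"
    using awalk_cyc_decompE'[OF assms(1)] by metis
  then have "awalk u (q @ s) v" by auto
  then have "length p \<le> length (q @ s)" by (rule assms(2))
  with qrs show False by (simp add: closed_w_def)
qed

text \<open>Lets walks replace paths in the definition of a geodesic: walks can be concatenated
  freely, with no distinctness to maintain.\<close>

lemma shortest_path_iff_awalk:
  "shortest_path G u p v \<longleftrightarrow> awalk u p v \<and> (\<forall>q. awalk u q v \<longrightarrow> length p \<le> length q)"
proof
  assume *: "shortest_path G u p v"
  then have p: "awalk u p v"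
    by (auto simp: shortest_path_def intro: awalkI_apath)
  \<comment> \<open>\<open>r\<close> is a shortest walk overall. It is a path, so \<open>p\<close>,
    minimal among paths only, cannot be longer.\<close>
  obtain r where r: "awalk u r v" "\<And>q. awalk u q v \<Longrightarrow> length r \<le> length q"
    using ex_has_least_nat[of "\<lambda>q. awalk u q v" p length] p by blast
  then have "apath u r v" by (rule minimal_awalk_imp_apath)
  then have "length p \<le> length r" using * by (simp add: shortest_path_def)
  with p r show "awalk u p v \<and> (\<forall>q. awalk u q v \<longrightarrow> length p \<le> length q)"
    by (meson le_trans)
next
  assume "awalk u p v \<and> (\<forall>q. awalk u q v \<longrightarrow> length p \<le> length q)"
  then show "shortest_path G u p v"
    by (auto simp: shortest_path_def intro: awalkI_apath minimal_awalk_imp_apath)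
qed

text \<open>Cut a shortest walk at \<open>w\<close>, or glue two walks there. Since
  \<open>i + j\<close> is itself the length of a walk from \<open>u\<close> to \<open>v\<close>, the
  last condition makes it the distance. Later distance arguments thereby become arithmetic on
  exponents.\<close>

lemma geodesic_interval_iff:
  assumes "u \<in> pverts G"
  shows "w \<in> geodesic_interval G u v \<longleftrightarrow>
    (\<exists>i j. (u, w) \<in> parcs G ^^ i \<and> (w, v) \<in> parcs G ^^ j \<and>
      (\<forall>k. (u, v) \<in> parcs G ^^ k \<longrightarrow> i + j \<le> k))"
    (is "?L \<longleftrightarrow> ?R")
proof
  assume ?L
  then obtain p where p: "awalk u p v" "\<And>q. awalk u q v \<Longrightarrow> length p \<le> length q"
      "w \<in> set (awalk_verts u p)"
    by (auto simp: geodesic_interval_def shortest_path_iff_awalk)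
  obtain q r where "p = q @ r" "awalk u q w" "awalk w r v"
    using awalk_decomp[OF p(1,3)] by blast
  then have "(u, w) \<in> parcs G ^^ length q" "(w, v) \<in> parcs G ^^ length r"
    "length q + length r = length p"
    by (auto intro: awalk_imp_relpow)
  with p(2) show ?R
    using relpow_imp_awalk[OF assms] by metis
next
  assume ?R
  then obtain i j where ij: "(u, w) \<in> parcs G ^^ i" "(w, v) \<in> parcs G ^^ j"
      "\<And>k. (u, v) \<in> parcs G ^^ k \<Longrightarrow> i + j \<le> k"
    by blast
  obtain q where q: "awalk u q w" "length q = i"
    using relpow_imp_awalk[OF assms ij(1)] by blast
  obtain r where r: "awalk w r v" "length r = j"
    using relpow_imp_awalk[OF awalk_last_in_verts[OF q(1)] ij(2)] by blast
  have "awalk u (q @ r) v" using q r by auto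
  moreover have "w \<in> set (awalk_verts u (q @ r))"
    using \<open>awalk u (q @ r) v\<close> hd_in_awalk_verts(1)[OF r(1)] q(1)
    by (auto simp: awalk_verts_append)
  moreover have "length (q @ r) \<le> length s" if "awalk u s v" for s
    using ij(3)[OF awalk_imp_relpow[OF that]] q r by simp
  ultimately show ?L
    unfolding geodesic_interval_def shortest_path_iff_awalk by blast
qed

lemma end_in_geodesic_interval:
  assumes "u \<in> pverts G" and "(u, v) \<in> (parcs G)\<^sup>*"
  shows "v \<in> geodesic_interval G u v"
proof -
  obtain k where "(u, v) \<in> parcs G ^^ k"
    using assms(2) by (auto simp: rtrancl_power)
  then have "(u, v) \<in> parcs G ^^ (LEAST k. (u, v) \<in> parcs G ^^ k)" by (rule LeastI)
  then show ?thesis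
    unfolding geodesic_interval_iff[OF assms(1)]
    by (intro exI[of _ "LEAST k. (u, v) \<in> parcs G ^^ k"] exI[of _ 0]) (auto intro: Least_le)
qed

text \<open>In a connected graph, a pair meeting a set \<open>S\<close> is resolved by its own
  member in \<open>S\<close>, so only pairs outside \<open>S\<close> need work later.\<close>

lemma strongly_resolves_self:
  assumes "u \<in> pverts G" "v \<in> pverts G"
    and "(u, v) \<in> (parcs G)\<^sup>*" "(v, u) \<in> (parcs G)\<^sup>*"
  shows "w = u \<or> w = v \<Longrightarrow> strongly_resolves G w u v"
  using end_in_geodesic_interval[OF assms(1,3)] end_in_geodesic_interval[OF assms(2,4)]
  by (auto simp: strongly_resolves_def)

lemma middle_in_geodesic_interval:
  assumes "(u, w) \<in> parcs G" "(w, v) \<in> parcs G" "u \<noteq> v" "(u, v) \<notin> parcs G"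
  shows "w \<in> geodesic_interval G u v"
proof -
  have "2 \<le> k" if "(u, v) \<in> parcs G ^^ k" for k
  proof (rule ccontr)
    assume "\<not> 2 \<le> k"
    then consider "k = 0" | "k = 1" by linarith
    then show False using that assms by cases auto
  qed
  then show ?thesis
    unfolding geodesic_interval_iff[OF wellformed'(1)[OF assms(1)]]
    using assms(1,2) by (intro exI[of _ "1::nat"]) (auto simp: numeral_2_eq_2)
qed

lemma interior_of_short_geodesic:
  assumes "w \<in> geodesic_interval G u v" "w \<noteq> u" "w \<noteq> v" "u \<in> pverts G"
    and "(u, v) \<in> parcs G ^^ k" "k \<le> 2"
  shows "(u, w) \<in> parcs G \<and> (w, v) \<in> parcs G \<and> u \<noteq> v \<and> (u, v) \<notin> parcs G"
proof -
  obtain i j where ij: "(u, w) \<in> parcs G ^^ i" "(w, v) \<in> parcs G ^^ j"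
      and least: "\<And>k. (u, v) \<in> parcs G ^^ k \<Longrightarrow> i + j \<le> k"
    using assms(1,4) by (auto simp: geodesic_interval_iff)
  have "i \<noteq> 0" "j \<noteq> 0" using ij assms(2,3) by (auto intro!: gr0I)
  then have "i = 1" "j = 1" using least[OF assms(5)] assms(6) by linarith+
  \<comment> \<open>Walks of length 0 or 1 would violate the least length 2, so the ends are neither
    equal nor adjacent.\<close>
  with ij least[of 0] least[of 1] show ?thesis by auto
qed

end

lemma (in pair_sym_digraph) relpow_sym:
  "(u, v) \<in> parcs G ^^ n \<Longrightarrow> (v, u) \<in> parcs G ^^ n"
proof (induction n arbitrary: v)
  case (Suc n)
  then obtain w where "(u, w) \<in> parcs G ^^ n" "(w, v) \<in> parcs G" by auto
  with Suc.IH show ?case by (meson arcs_symmetric relpow_Suc_I2)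
qed simp

lemma (in pair_sym_digraph) geodesic_interval_commute:
  assumes "u \<in> pverts G" "v \<in> pverts G"
  shows "geodesic_interval G u v = geodesic_interval G v u"
proof -
  have "geodesic_interval G x y \<subseteq> geodesic_interval G y x"
    if x: "x \<in> pverts G" and y: "y \<in> pverts G" for x y
  proof
    fix w assume "w \<in> geodesic_interval G x y"
    then obtain i j where "(x, w) \<in> parcs G ^^ i" "(w, y) \<in> parcs G ^^ j"
        "\<And>k. (x, y) \<in> parcs G ^^ k \<Longrightarrow> i + j \<le> k"
      unfolding geodesic_interval_iff[OF x] by blast
    then have "(y, w) \<in> parcs G ^^ j" "(w, x) \<in> parcs G ^^ i"
        "\<And>k. (y, x) \<in> parcs G ^^ k \<Longrightarrow> j + i \<le> k"
      by (auto dest: relpow_sym simp: add.commute)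
    then show "w \<in> geodesic_interval G y x"
      unfolding geodesic_interval_iff[OF y] by blast
  qed
  then show ?thesis using assms by blast
qed

section \<open>Graphs of diameter at most two\<close>

lemma finite_strong_resolving_sets:
  "finite (pverts X) \<Longrightarrow> finite {S. strong_resolving_set X S}"
  by (rule finite_subset[of _ "Pow (pverts X)"]) (auto simp: strong_resolving_set_def)

lemma strong_metric_dim_eqI:
  assumes "finite (pverts X)" "strong_resolving_set X S" "card S = n"
    and "\<And>T. strong_resolving_set X T \<Longrightarrow> n \<le> card T"
  shows "strong_metric_dim X = n"
  unfolding strong_metric_dim_def
  by (rule Min_eqI) (use assms finite_strong_resolving_sets in auto)

lemma finite_twin_free_cliques:
  "finite (pverts X) \<Longrightarrow> finite {C. twin_free_clique X C}"
  by (rule finite_subset[of _ "Pow (pverts X)"]) (auto simp: twin_free_clique_def clique_def)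

lemma card_le_twin_free_clique_number:
  "finite (pverts X) \<Longrightarrow> twin_free_clique X C \<Longrightarrow> card C \<le> twin_free_clique_number X"
  unfolding twin_free_clique_number_def
  by (rule Max_ge) (use finite_twin_free_cliques in auto)

lemma twin_free_clique_number_attained:
  assumes "finite (pverts X)"
  obtains C where "twin_free_clique X C" "card C = twin_free_clique_number X"
proof -
  have "twin_free_clique X {}" by (simp add: twin_free_clique_def clique_def)
  then have "twin_free_clique_number X \<in> card ` {C. twin_free_clique X C}"
    unfolding twin_free_clique_number_def
    by (intro Max_in) (use assms finite_twin_free_cliques in auto)
  with that show thesis by auto
qed

text \<open>Adjacent vertices both lie in both closed neighbourhoods, so only the other vertices can
  tell them apart.\<close>

lemma (in pair_graph) true_twins_iff:
  assumes "u \<in> pverts G" "v \<in> pverts G" "(u, v) \<in> parcs G"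
  shows "true_twins G u v \<longleftrightarrow>
    (\<forall>w \<in> pverts G - {u, v}. (u, w) \<in> parcs G \<longleftrightarrow> (v, w) \<in> parcs G)"
  using assms arcs_symmetric[OF assms(3)]
  by (auto simp: true_twins_def closed_nbhd_def set_eq_iff dest: wellformed' no_loops')

lemma (in pair_graph) strong_resolving_set_diameter_two:
  assumes diam: "\<And>u v. u \<in> pverts G \<Longrightarrow> v \<in> pverts G \<Longrightarrow> \<exists>k \<le> 2. (u, v) \<in> parcs G ^^ k"
    and "S \<subseteq> pverts G"
  shows "strong_resolving_set G S \<longleftrightarrow> twin_free_clique G (pverts G - S)"
proof
  assume S: "strong_resolving_set G S"
  have *: "(u, v) \<in> parcs G \<and> \<not> true_twins G u v" 
    if uv: "u \<in> pverts G" "v \<in> pverts G" "u \<notin> S" "v \<notin> S" "u \<noteq> v" for u v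
  proof -
    obtain w where w: "w \<in> S" "strongly_resolves G w u v"
      using S uv by (meson strong_resolving_set_def)
    then have w': "w \<noteq> u" "w \<noteq> v" "w \<in> pverts G" using uv \<open>S \<subseteq> pverts G\<close> by auto
    \<comment> \<open>As \<open>w\<close> differs from \<open>u\<close> and \<open>v\<close>, the
      resolved pair and \<open>w\<close> form a geodesic of length two, with one of the pair in the
      middle.\<close>
    have interior: "(x, y) \<in> parcs G \<and> (y, w) \<in> parcs G \<and> (x, w) \<notin> parcs G"
      if "y \<in> geodesic_interval G x w" "y \<noteq> x" "y \<noteq> w" "x \<in> pverts G" for x y
      using diam[OF that(4) w'(3)] interior_of_short_geodesic[OF that] by blast
    have "(u, v) \<in> parcs G \<and> (v, w) \<in> parcs G \<and> (u, w) \<notin> parcs G \<or>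
        (v, u) \<in> parcs G \<and> (u, w) \<in> parcs G \<and> (v, w) \<notin> parcs G"
      using w(2) interior[of v u] interior[of u v] uv w' by (auto simp: strongly_resolves_def)
    then have "(u, v) \<in> parcs G" and "(u, w) \<in> parcs G \<longleftrightarrow> (v, w) \<notin> parcs G"
      by (auto intro: arcs_symmetric)
    with uv w' true_twins_iff[of u v] show ?thesis by auto
  qed
  then show "twin_free_clique G (pverts G - S)"
    unfolding twin_free_clique_def clique_def by (auto simp: true_twins_def)
next
  assume C: "twin_free_clique G (pverts G - S)"
  show "strong_resolving_set G S"
    unfolding strong_resolving_set_def
  proof (intro conjI ballI impI)
    fix u v assume uv: "u \<in> pverts G" "v \<in> pverts G" "u \<noteq> v"
    have reach: "(x, y) \<in> (parcs G)\<^sup>*" if "x \<in> pverts G" "y \<in> pverts G" for x y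
      using diam[OF that] by (auto simp: rtrancl_power)
    show "\<exists>w\<in>S. strongly_resolves G w u v"
    proof (cases "u \<in> S \<or> v \<in> S")
      case True
      then show ?thesis using strongly_resolves_self uv reach by blast
    next
      case False
      then have arc: "(u, v) \<in> parcs G" "(v, u) \<in> parcs G" and "\<not> true_twins G u v"
        using C uv by (auto simp: twin_free_clique_def clique_def)
      then obtain w where w: "w \<in> pverts G" "w \<noteq> u" "w \<noteq> v"
          "(u, w) \<in> parcs G \<and> (v, w) \<notin> parcs G \<or> (v, w) \<in> parcs G \<and> (u, w) \<notin> parcs G"
        using uv true_twins_iff by blast
      then have "strongly_resolves G w u v"
        unfolding strongly_resolves_def
        using arc middle_in_geodesic_interval by metis
      \<comment> \<open>\<open>w\<close> is adjacent to exactly one of \<open>u\<close> and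
        \<open>v\<close>, whereas a further clique member would be adjacent to both.\<close>
      moreover have "w \<in> S"
      proof (rule ccontr)
        assume "w \<notin> S"
        then have "(u, w) \<in> parcs G" "(v, w) \<in> parcs G"
          using C uv False w(1-3) by (auto simp: twin_free_clique_def clique_def)
        with w(4) show False by blast
      qed
      ultimately show ?thesis by blast
    qed
  qed fact
qed

text \<open>Complementation exchanges strong resolving sets with twin-free cliques, hence a minimum
  with a maximum.\<close>

lemma (in pair_graph) strong_metric_dim_diameter_two:
  assumes diam: "\<And>u v. u \<in> pverts G \<Longrightarrow> v \<in> pverts G \<Longrightarrow> \<exists>k \<le> 2. (u, v) \<in> parcs G ^^ k"
  shows "strong_metric_dim G = card (pverts G) - twin_free_clique_number G"
proof -
  obtain C where C: "twin_free_clique G C" "card C = twin_free_clique_number G"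
    using twin_free_clique_number_attained[OF pair_finite_verts] .
  have sub: "C \<subseteq> pverts G" using C(1) by (simp add: twin_free_clique_def clique_def)
  show ?thesis
  proof (rule strong_metric_dim_eqI[OF pair_finite_verts])
    show "strong_resolving_set G (pverts G - C)"
      using C(1) sub strong_resolving_set_diameter_two[OF diam] by (simp add: double_diff)
    show "card (pverts G - C) = card (pverts G) - twin_free_clique_number G"
      using C(2) sub pair_finite_verts by (metis card_Diff_subset finite_subset)
    fix T assume T: "strong_resolving_set G T"
    then have TV: "T \<subseteq> pverts G" by (simp add: strong_resolving_set_def)
    then have "card (pverts G - T) \<le> twin_free_clique_number G"
      using T strong_resolving_set_diameter_two[OF diam] pair_finite_verts
      by (intro card_le_twin_free_clique_number) auto
    then show "card (pverts G) - twin_free_clique_number G \<le> card T"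
      using TV pair_finite_verts by (simp add: card_Diff_subset finite_subset)
  qed
qed

section \<open>Joins with a single vertex\<close>

lemma (in pair_graph) out_degree_card: "out_degree G v = card {w. (v, w) \<in> parcs G}"
proof -
  have "out_arcs G v = Pair v ` {w. (v, w) \<in> parcs G}"
    by (auto simp: out_arcs_def)
  then show ?thesis
    by (simp add: out_degree_def card_image inj_on_def)
qed

text \<open>The out-neighbours lie in the finite set \<open>pverts G - {v}\<close>, so equal
  cardinality already forces equality.\<close>

lemma (in pair_graph) out_degree_universal:
  assumes "v \<in> pverts G"
  shows "Suc (out_degree G v) = card (pverts G) \<longleftrightarrow> (\<forall>w \<in> pverts G - {v}. (v, w) \<in> parcs G)"
proof -
  have sub: "{w. (v, w) \<in> parcs G} \<subseteq> pverts G - {v}"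
    by (auto dest: wellformed' no_loops')
  have card: "Suc (card (pverts G - {v})) = card (pverts G)"
    by (rule card_Suc_Diff1[OF pair_finite_verts assms])
  have "finite (pverts G - {v})" using pair_finite_verts by simp
  then have "out_degree G v = card (pverts G - {v}) \<longleftrightarrow> {w. (v, w) \<in> parcs G} = pverts G - {v}"
    unfolding out_degree_card using card_subset_eq[OF _ sub] by metis
  with sub card show ?thesis by auto
qed

lemma pverts_join_K1: "pverts (graph_join K1 H) = insert (Inl ()) (Inr ` pverts H)"
  by (auto simp: graph_join_def K1_def)

lemma parcs_join_K1:
  "(Inr x, Inr y) \<in> parcs (graph_join K1 H) \<longleftrightarrow> (x, y) \<in> parcs H"
  "(Inl (), Inr y) \<in> parcs (graph_join K1 H) \<longleftrightarrow> y \<in> pverts H"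
  "(Inr x, Inl ()) \<in> parcs (graph_join K1 H) \<longleftrightarrow> x \<in> pverts H"
  "(Inl (), Inl ()) \<notin> parcs (graph_join K1 H)"
  by (auto simp: graph_join_def K1_def)

lemma diameter_join_K1:
  assumes "u \<in> pverts (graph_join K1 H)" "v \<in> pverts (graph_join K1 H)"
  shows "\<exists>k \<le> 2. (u, v) \<in> parcs (graph_join K1 H) ^^ k"
proof -
  let ?R = "parcs (graph_join K1 H)"
  consider "u = v" | "(u, v) \<in> ?R" | "(u, Inl ()) \<in> ?R" "(Inl (), v) \<in> ?R"
    using assms by (auto simp: pverts_join_K1 parcs_join_K1)
  then show ?thesis
  proof cases
    case 1 then show ?thesis by (intro exI[of _ 0]) auto
  next
    case 2 then show ?thesis by (intro exI[of _ "1::nat"]) auto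
  next
    case 3 then show ?thesis by (intro exI[of _ "2::nat"]) (auto simp: numeral_2_eq_2)
  qed
qed

text \<open>Each closed neighbourhood merely gains the common apex \<open>Inl ()\<close>.\<close>

lemma true_twins_join_K1:
  assumes "x \<in> pverts H" "y \<in> pverts H"
  shows "true_twins (graph_join K1 H) (Inr x) (Inr y) \<longleftrightarrow> true_twins H x y"
proof -
  have "closed_nbhd (graph_join K1 H) (Inr z) = insert (Inl ()) (Inr ` closed_nbhd H z)"
    if "z \<in> pverts H" for z
  proof (rule set_eqI)
    fix w :: "unit + 'a"
    show "w \<in> closed_nbhd (graph_join K1 H) (Inr z) \<longleftrightarrow>
      w \<in> insert (Inl ()) (Inr ` closed_nbhd H z)"
      using that by (cases w) (auto simp: closed_nbhd_def parcs_join_K1)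
  qed
  moreover have "insert (Inl ()) (Inr ` A) = insert (Inl ()) (Inr ` B) \<longleftrightarrow> A = B" for A B :: "'a set"
    by (auto simp: set_eq_iff image_iff)
  ultimately show ?thesis
    using assms by (auto simp: true_twins_def pverts_join_K1)
qed

lemma twin_free_clique_join_K1:
  assumes "C \<subseteq> pverts H"
  shows "twin_free_clique (graph_join K1 H) (Inr ` C) \<longleftrightarrow> twin_free_clique H C"
proof -
  have "(\<exists>x \<in> C. \<exists>y \<in> C. true_twins (graph_join K1 H) (Inr x) (Inr y)) \<longleftrightarrow>
      (\<exists>x \<in> C. \<exists>y \<in> C. true_twins H x y)"
    using assms true_twins_join_K1 by (meson subsetD)
  moreover have "clique (graph_join K1 H) (Inr ` C) \<longleftrightarrow> clique H C"
    using assms by (auto simp: clique_def pverts_join_K1 parcs_join_K1)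
  ultimately show ?thesis by (simp add: twin_free_clique_def)
qed

text \<open>The universal vertex \<open>u\<close> keeps the number from growing: if \<open>H\<close>
  had none, the apex could be added to any twin-free clique of \<open>H\<close> without creating
  twins.\<close>

lemma twin_free_clique_number_join_K1:
  assumes "pair_graph H" and u: "u \<in> pverts H" "\<forall>w \<in> pverts H - {u}. (u, w) \<in> parcs H"
  shows "twin_free_clique_number (graph_join K1 H) = twin_free_clique_number H"
proof -
  interpret H: pair_graph H by fact
  interpret J: pair_graph "graph_join K1 H" by (rule pair_graph_join[OF pair_graph_K1]) fact
  let ?J = "graph_join K1 H"
  show ?thesis
  proof (rule antisym)
    obtain C where C: "twin_free_clique H C" "card C = twin_free_clique_number H"
      using twin_free_clique_number_attained[OF H.pair_finite_verts] .
    then have "twin_free_clique ?J (Inr ` C)"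
      by (subst twin_free_clique_join_K1) (auto simp: twin_free_clique_def clique_def)
    with C(2) show "twin_free_clique_number H \<le> twin_free_clique_number ?J"
      using card_le_twin_free_clique_number[OF J.pair_finite_verts]
      by (metis card_image inj_Inr)
  next
    obtain C where C: "twin_free_clique ?J C" "card C = twin_free_clique_number ?J"
      using twin_free_clique_number_attained[OF J.pair_finite_verts] .
    define D where "D = Inr -` C"
    have CV: "C \<subseteq> pverts ?J" using C(1) by (simp add: twin_free_clique_def clique_def)
    then have DV: "D \<subseteq> pverts H" by (auto simp: D_def pverts_join_K1)
    then have fin: "finite D" using H.pair_finite_verts finite_subset by blast
    have CD: "C - {Inl ()} = Inr ` D"
      using CV by (auto simp: D_def pverts_join_K1)
    have "twin_free_clique ?J (C - {Inl ()})"
      using C(1) by (auto simp: twin_free_clique_def clique_def)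
    then have D: "twin_free_clique H D"
      unfolding CD using DV by (simp add: twin_free_clique_join_K1)
    show "twin_free_clique_number ?J \<le> twin_free_clique_number H"
    proof (cases "Inl () \<in> C")
      case False
      then have "card C = card D" using CD by (simp add: card_image)
      with C(2) D show ?thesis
        using card_le_twin_free_clique_number[OF H.pair_finite_verts] by metis
    next
      case True
      \<comment> \<open>The vertex of \<^const>\<open>K1\<close> is a true twin of every universal vertex of \<open>H\<close>, so it may be
        replaced by \<open>u\<close>.\<close>
      have nbhd: "closed_nbhd ?J (Inl ()) = pverts ?J"
        by (auto simp: closed_nbhd_def pverts_join_K1 parcs_join_K1 dest: J.wellformed')
      \<comment> \<open>A vertex of \<open>D\<close> universal in \<open>H\<close> would be
        universal in the join as well, and so a true twin of the apex within
        \<open>C\<close>.\<close>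
      have no_univ: "closed_nbhd H x \<noteq> pverts H" if "x \<in> D" for x
      proof
        assume x: "closed_nbhd H x = pverts H"
        have xV: "x \<in> pverts H" using that DV by auto
        have "Inr y \<in> closed_nbhd ?J (Inr x)" if "y \<in> pverts H" for y
          using that x by (auto simp: closed_nbhd_def parcs_join_K1)
        then have "closed_nbhd ?J (Inr x) = pverts ?J"
          using xV by (fastforce simp: pverts_join_K1 closed_nbhd_def parcs_join_K1 dest: J.wellformed')
        then have "true_twins ?J (Inl ()) (Inr x)"
          using nbhd xV by (auto simp: true_twins_def pverts_join_K1)
        moreover have "Inr x \<in> C" using that by (simp add: D_def)
        ultimately show False using C(1) True by (auto simp: twin_free_clique_def)
      qed
      have nbhd_u: "closed_nbhd H u = pverts H"
        using u by (auto simp: closed_nbhd_def dest: H.wellformed')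
      have "u \<notin> D" using no_univ nbhd_u by blast
      have "twin_free_clique H (insert u D)"
        using D u no_univ nbhd_u DV
        unfolding twin_free_clique_def
      proof (intro conjI)
        show "clique H (insert u D)"
          using D u DV by (auto simp: twin_free_clique_def clique_def intro: H.arcs_symmetric)
        have "\<not> true_twins H u x" "\<not> true_twins H x u" if "x \<in> D" for x
          using no_univ[OF that] nbhd_u by (auto simp: true_twins_def)
        moreover have "\<not> true_twins H u u" by (simp add: true_twins_def)
        ultimately show "\<not> (\<exists>x \<in> insert u D. \<exists>y \<in> insert u D. true_twins H x y)"
          using D by (auto simp: twin_free_clique_def)
      qed
      moreover have "card (insert u D) = card C"
      proof -
        have "card C = Suc (card (C - {Inl ()}))"
          using card_Suc_Diff1[OF finite_subset[OF CV J.pair_finite_verts] True] by simp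
        then show ?thesis using fin \<open>u \<notin> D\<close> by (simp add: CD card_image)
      qed
      ultimately show ?thesis
        using C(2) card_le_twin_free_clique_number[OF H.pair_finite_verts] by metis
    qed
  qed
qed

section \<open>Coronas\<close>

text \<open>Nonemptiness of \<open>H\<close> provides a copy vertex at every hub
  \<open>Inl u\<close>, from which pairs involving that hub can be resolved.\<close>

locale connected_corona = G: pair_graph G + H: pair_graph H
  for G :: "'a pair_pre_digraph" and H :: "'b pair_pre_digraph" +
  assumes G_connected: "Digraph_Component.connected (with_proj G)"
    and H_nonempty: "pverts H \<noteq> {}"
begin

abbreviation R :: "('a + 'a \<times> 'b) rel" where
  "R \<equiv> parcs (corona G H)"

sublocale C: pair_graph "corona G H"
  by (rule pair_graph_corona) unfold_locales

lemma pverts_corona: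
  "Inl v \<in> pverts (corona G H) \<longleftrightarrow> v \<in> pverts G"
  "Inr (v, x) \<in> pverts (corona G H) \<longleftrightarrow> v \<in> pverts G \<and> x \<in> pverts H"
  by (auto simp: corona_def)

lemma parcs_corona:
  "(Inl u, Inl v) \<in> R \<longleftrightarrow> (u, v) \<in> parcs G"
  "(Inr (u, x), Inr (v, y)) \<in> R \<longleftrightarrow> u = v \<and> v \<in> pverts G \<and> (x, y) \<in> parcs H"
  "(Inl u, Inr (v, y)) \<in> R \<longleftrightarrow> u = v \<and> v \<in> pverts G \<and> y \<in> pverts H"
  "(Inr (v, y), Inl u) \<in> R \<longleftrightarrow> u = v \<and> v \<in> pverts G \<and> y \<in> pverts H"
  by (auto simp: corona_def)

section \<open>Connectedness of the corona\<close>

lemma reachable_Inl: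
  assumes "u \<in> pverts G" "v \<in> pverts G"
  shows "(Inl u, Inl v) \<in> R\<^sup>*"
proof -
  have "u \<rightarrow>\<^sup>*\<^bsub>with_proj (mk_symmetric (with_proj G))\<^esub> v"
    using G_connected assms by (auto simp: connected_def strongly_connected_def)
  \<comment> \<open>Connectedness is phrased for the symmetric closure, but \<open>G\<close> is
    already symmetric, so reachability is unchanged.\<close>
  then have "(u, v) \<in> (parcs G)\<^sup>*"
    using G.reachable_mk_symmetric_eq[OF G.sym_arcs] rtrancl_on_rtranclI
    by (auto simp: reachable_def)
  then show ?thesis
    by induction (auto simp: parcs_corona intro: rtrancl_into_rtrancl)
qed

lemma corona_reachable:
  assumes "s \<in> pverts (corona G H)" "t \<in> pverts (corona G H)"
  shows "(s, t) \<in> R\<^sup>*"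
proof -
  have hub: "\<exists>v \<in> pverts G. (w, Inl v) \<in> R\<^sup>* \<and> (Inl v, w) \<in> R\<^sup>*"
    if "w \<in> pverts (corona G H)" for w
  proof (cases w)
    case (Inl v)
    then show ?thesis using that by (auto simp: pverts_corona)
  next
    case (Inr p)
    then obtain v x where "w = Inr (v, x)" by (cases p) simp
    then have "(w, Inl v) \<in> R" "(Inl v, w) \<in> R" "v \<in> pverts G"
      using that by (auto simp: pverts_corona parcs_corona)
    then show ?thesis by blast
  qed
  show ?thesis
    using hub[OF assms(1)] hub[OF assms(2)] reachable_Inl by (meson rtrancl_trans)
qed

section \<open>Geodesics and the copies of \<open>H\<close>\<close>

text \<open>A copy can be entered only through its hub, and at least one more step follows. This
  strict bound is what makes a detour through a copy too long.\<close>

lemma walk_into_copy: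
  assumes "(s, Inr (v, x)) \<in> R ^^ n" and "\<And>y. s \<noteq> Inr (v, y)"
  shows "\<exists>i < n. (s, Inl v) \<in> R ^^ i"
  using assms(1)
proof (induction n arbitrary: x)
  case 0
  with assms(2) show ?case by simp
next
  case (Suc n)
  then obtain t where t: "(s, t) \<in> R ^^ n" "(t, Inr (v, x)) \<in> R" by auto
  show ?case
  proof (cases t)
    case (Inl u)
    with t show ?thesis by (auto simp: parcs_corona)
  next
    case (Inr p)
    with t obtain y where "t = Inr (v, y)" by (cases p) (auto simp: parcs_corona)
    with t(1) Suc.IH show ?thesis using less_SucI by blast
  qed
qed

text \<open>The hub dominates its copy: a first arc to the hub is dropped, and a first arc inside
  the copy is replaced by one from the hub. The second case saves nothing, so the bound is not
  strict.\<close>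

lemma walk_out_of_copy:
  assumes "(Inr (v, x), t) \<in> R ^^ n" and "n \<noteq> 0"
  shows "\<exists>i \<le> n. (Inl v, t) \<in> R ^^ i"
proof -
  obtain m where n: "n = Suc m" using assms(2) not0_implies_Suc by blast
  obtain w where w: "(Inr (v, x), w) \<in> R" "(w, t) \<in> R ^^ m"
    using assms(1) unfolding n by (meson relpow_Suc_E2)
  show ?thesis
  proof (cases w)
    case (Inl u)
    with w(1) have "w = Inl v" by (simp add: parcs_corona)
    with w(2) n show ?thesis using le_SucI by blast
  next
    case (Inr p)
    with w(1) have "(Inl v, w) \<in> R"
      by (cases p) (auto simp: parcs_corona dest: H.wellformed')
    then have "(Inl v, t) \<in> R ^^ n"
      using w(2) unfolding n by (rule relpow_Suc_I2)
    then show ?thesis by blast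
  qed
qed

text \<open>Any walk from \<open>s\<close> into the copy costs at least the distance to the hub plus
  one, and going to the hub and then one step further attains this.\<close>

lemma hub_in_geodesic_interval:
  assumes s: "s \<in> pverts (corona G H)" "\<And>y. s \<noteq> Inr (v, y)"
    and v: "v \<in> pverts G" and x: "x \<in> pverts H"
  shows "Inl v \<in> geodesic_interval (corona G H) s (Inr (v, x))"
proof -
  define i where "i = (LEAST i. (s, Inl v) \<in> R ^^ i)"
  have "\<exists>i. (s, Inl v) \<in> R ^^ i"
    using corona_reachable[OF s(1), of "Inl v"] v by (simp add: pverts_corona rtrancl_power)
  then have "(s, Inl v) \<in> R ^^ i" unfolding i_def by (rule LeastI_ex)
  moreover have "(Inl v, Inr (v, x)) \<in> R ^^ 1"
    using v x by (simp add: parcs_corona)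
  moreover have "i + 1 \<le> k" if "(s, Inr (v, x)) \<in> R ^^ k" for k
  proof -
    obtain m where "m < k" "(s, Inl v) \<in> R ^^ m"
      using walk_into_copy[OF \<open>(s, Inr (v, x)) \<in> R ^^ k\<close> s(2)] by blast
    moreover from this have "i \<le> m" unfolding i_def by (auto intro: Least_le)
    ultimately show ?thesis by simp
  qed
  ultimately show ?thesis
    unfolding C.geodesic_interval_iff[OF s(1)] by blast
qed

text \<open>From outside the copy, turning at the hub instead of visiting \<open>z\<close> saves a
  step on the way in and loses none on the way out.\<close>

lemma geodesic_through_copy_starts_in_copy:
  assumes "Inr (v, z) \<in> geodesic_interval (corona G H) s t"
    and s: "s \<in> pverts (corona G H)" and "t \<noteq> Inr (v, z)"
  shows "\<exists>x. s = Inr (v, x)"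
proof (rule ccontr)
  assume outside: "\<nexists>x. s = Inr (v, x)"
  obtain i j where ij: "(s, Inr (v, z)) \<in> R ^^ i" "(Inr (v, z), t) \<in> R ^^ j"
      and least: "\<And>k. (s, t) \<in> R ^^ k \<Longrightarrow> i + j \<le> k"
    using assms(1) unfolding C.geodesic_interval_iff[OF s] by blast
  obtain i' where i': "i' < i" "(s, Inl v) \<in> R ^^ i'"
    using walk_into_copy[OF ij(1)] outside by blast
  have "j \<noteq> 0" using ij(2) assms(3) by (cases j) auto
  then obtain j' where j': "j' \<le> j" "(Inl v, t) \<in> R ^^ j'"
    using walk_out_of_copy[OF ij(2)] by blast
  have "(s, t) \<in> R ^^ (i' + j')"
    using i'(2) j'(2) by (auto simp: relpow_add)
  then have "i + j \<le> i' + j'" by (rule least)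
  with i'(1) j'(1) show False by simp
qed

text \<open>Symmetry of intervals puts both ends in the copy. The hub then joins them in two steps,
  which leaves only geodesics of length two.\<close>

lemma geodesic_through_copy:
  assumes z: "Inr (v, z) \<in> geodesic_interval (corona G H) s t"
    and s: "s \<in> pverts (corona G H)" "s \<noteq> Inr (v, z)"
    and t: "t \<in> pverts (corona G H)" "t \<noteq> Inr (v, z)"
  obtains x y where "s = Inr (v, x)" "t = Inr (v, y)"
    "(x, z) \<in> parcs H" "(z, y) \<in> parcs H" "x \<noteq> y" "(x, y) \<notin> parcs H"
proof -
  obtain x where x: "s = Inr (v, x)"
    using geodesic_through_copy_starts_in_copy[OF z s(1) t(2)] by blast
  obtain y where y: "t = Inr (v, y)"
    using geodesic_through_copy_starts_in_copy[OF _ t(1) s(2)] z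
      C.geodesic_interval_commute[OF s(1) t(1)] by blast
  have V: "v \<in> pverts G" "x \<in> pverts H" "y \<in> pverts H"
    using s(1) t(1) x y by (auto simp: pverts_corona)
  then have "(s, Inl v) \<in> R" "(Inl v, t) \<in> R" by (auto simp: x y parcs_corona)
  then have "(s, t) \<in> R ^^ 2" by (auto simp: numeral_2_eq_2)
  from C.interior_of_short_geodesic[OF z _ _ s(1) this]
  have "(s, Inr (v, z)) \<in> R \<and> (Inr (v, z), t) \<in> R \<and> s \<noteq> t \<and> (s, t) \<notin> R"
    using s(2) t(2) by auto
  then show thesis using that x y V by (auto simp: parcs_corona)
qed

section \<open>Lower bound for the corona\<close>

lemma unresolved_copy_vertices:
  assumes S: "strong_resolving_set (corona G H) S"
    and V: "u \<in> pverts G" "v \<in> pverts G" "x \<in> pverts H" "y \<in> pverts H"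
    and out: "Inr (u, x) \<notin> S" "Inr (v, y) \<notin> S" and ne: "(u, x) \<noteq> (v, y)"
  shows "u = v \<and> (x, y) \<in> parcs H \<and> \<not> true_twins H x y"
proof -
  have pV: "Inr (u, x) \<in> pverts (corona G H)" "Inr (v, y) \<in> pverts (corona G H)"
    using V by (auto simp: pverts_corona)
  then obtain w where w: "w \<in> S" "strongly_resolves (corona G H) w (Inr (u, x)) (Inr (v, y))"
    using S ne unfolding strong_resolving_set_def by (metis sum.inject(2))
  have wV: "w \<in> pverts (corona G H)" "w \<noteq> Inr (u, x)" "w \<noteq> Inr (v, y)"
    using w(1) S out by (auto simp: strong_resolving_set_def)
  have *: "a = b \<and> (p, q) \<in> parcs H \<and> (q, p) \<in> parcs H \<and> \<not> true_twins H p q \<and> \<not> true_twins H q p"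
    if I: "Inr (b, q) \<in> geodesic_interval (corona G H) (Inr (a, p)) w"
      and V': "Inr (a, p) \<in> pverts (corona G H)" "(a, p) \<noteq> (b, q)" "w \<noteq> Inr (b, q)"
    for a b p q
  proof -
    have "Inr (a, p) \<noteq> Inr (b, q)" using V'(2) by simp
    from geodesic_through_copy[OF I V'(1) this wV(1) V'(3)]
    obtain z where z: "a = b" "(p, q) \<in> parcs H" "(q, z) \<in> parcs H" "p \<noteq> z" "(p, z) \<notin> parcs H"
      by (metis old.prod.inject sum.inject(2))
    \<comment> \<open>The far end \<open>z\<close> of the geodesic separates the closed
      neighbourhoods of its other two vertices.\<close>
    then have "z \<in> closed_nbhd H q" "z \<notin> closed_nbhd H p"
      by (auto simp: closed_nbhd_def)
    with z show ?thesis by (auto simp: true_twins_def intro: H.arcs_symmetric)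
  qed
  from w(2) show ?thesis
    unfolding strongly_resolves_def
    using *[of v y u x] *[of u x v y] pV wV ne by auto
qed

lemma strong_resolving_set_corona_card:
  assumes S: "strong_resolving_set (corona G H) S"
  shows "card (pverts G) * card (pverts H) \<le> card S + twin_free_clique_number H"
proof -
  \<comment> \<open>\<open>D\<close> collects the copy vertices that \<open>S\<close> misses. Hubs
    in \<open>S\<close> are disregarded, as they only increase its size.\<close>
  define D where "D = {p \<in> pverts G \<times> pverts H. Inr p \<notin> S}"
  have D: "u = v \<and> (x, y) \<in> parcs H \<and> \<not> true_twins H x y"
    if "(u, x) \<in> D" "(v, y) \<in> D" "(u, x) \<noteq> (v, y)" for u v x y
    using unresolved_copy_vertices[OF S] that by (auto simp: D_def)
  have "finite S"
    using S C.pair_finite_verts by (auto simp: strong_resolving_set_def intro: finite_subset)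
  have finGH: "finite (pverts G \<times> pverts H)"
    using G.pair_finite_verts H.pair_finite_verts by simp
  have "twin_free_clique H (snd ` D)"
    unfolding twin_free_clique_def clique_def
  proof (intro conjI ballI impI notI)
    show "snd ` D \<subseteq> pverts H" by (auto simp: D_def)
  next
    fix x y assume "x \<in> snd ` D" "y \<in> snd ` D" "x \<noteq> y"
    then show "(x, y) \<in> parcs H" using D by fastforce
  next
    assume "\<exists>x \<in> snd ` D. \<exists>y \<in> snd ` D. true_twins H x y"
    then obtain u x v y where uv: "(u, x) \<in> D" "(v, y) \<in> D" "true_twins H x y" by force
    then have "x \<noteq> y" by (simp add: true_twins_def)
    with D[OF uv(1,2)] uv(3) show False by simp
  qed
  \<comment> \<open>Distinct members of \<open>D\<close> with the same second component would yield
    a loop in \<open>H\<close>.\<close>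
  moreover have "inj_on snd D"
    using D by (intro inj_onI) (metis H.no_loops' prod.collapse)
  ultimately have cardD: "card D \<le> twin_free_clique_number H"
    using card_le_twin_free_clique_number[OF H.pair_finite_verts] by (metis card_image)
  have "card (pverts G \<times> pverts H - D) \<le> card S"
    by (rule card_inj_on_le[of Inr]) (use \<open>finite S\<close> in \<open>auto simp: D_def\<close>)
  moreover have "card (pverts G \<times> pverts H) = card D + card (pverts G \<times> pverts H - D)"
    using card_Int_Diff[OF finGH, of D] by (simp add: D_def Int_absorb1)
  ultimately show ?thesis
    using cardD by (simp add: card_cartesian_product)
qed

section \<open>Upper bound for the corona\<close>

text \<open>The set omits every hub and one twin-free clique, so its size meets the lower bound when
  \<open>D\<close> is maximum. \<open>nonuniv\<close> is there for the pairs of the hub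
  \<open>Inl v\<close> with a clique vertex.\<close>

lemma strong_resolving_set_corona:
  assumes nonuniv: "2 \<le> card (pverts G) \<or> (\<forall>x \<in> pverts H. \<exists>z \<in> pverts H - {x}. (x, z) \<notin> parcs H)"
    and v: "v \<in> pverts G" and D: "twin_free_clique H D"
  shows "strong_resolving_set (corona G H) (Inr ` (pverts G \<times> pverts H - {v} \<times> D))"
proof -
  let ?S = "Inr ` (pverts G \<times> pverts H - {v} \<times> D) :: ('a + 'a \<times> 'b) set"
  define res where "res s t \<longleftrightarrow> (\<exists>w \<in> ?S. strongly_resolves (corona G H) w s t)" for s t
  have res_sym: "res t s" if "res s t" for s t
    using that by (auto simp: res_def strongly_resolves_def)
  have DV: "D \<subseteq> pverts H" using D by (simp add: twin_free_clique_def clique_def)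
  obtain h where h: "h \<in> pverts H" using H_nonempty by blast
  have res_hub: "res (Inl u) s"
    if "u \<in> pverts G" "u \<noteq> v" "s \<in> pverts (corona G H)" "\<And>y. s \<noteq> Inr (u, y)" for u s
  proof -
    \<comment> \<open>For \<open>u \<noteq> v\<close> the copy at \<open>u\<close> lies wholly in
      \<open>?S\<close>, and \<open>s\<close> reaches it only through its hub.\<close>
    have "Inr (u, h) \<in> ?S" using that(1,2) h by auto
    then show ?thesis
      using hub_in_geodesic_interval[OF that(3,4,1) h] by (auto simp: res_def strongly_resolves_def)
  qed
  have res_hub_copy: "res (Inl u) (Inr (v, x))" if u: "u \<in> pverts G" and x: "x \<in> D" for u x
  proof (cases "u = v")
    case False
    then show ?thesis using res_hub[OF u] v x DV by (auto simp: pverts_corona)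
  next
    case True
    have xV: "x \<in> pverts H" using x DV by auto
    have arc: "(Inr (v, x), Inl v) \<in> R" "(Inl v, Inr (v, x)) \<in> R"
      using v xV by (auto simp: parcs_corona)
    show ?thesis
    proof (cases "2 \<le> card (pverts G)")
      case True
      then obtain u' where u': "u' \<in> pverts G" "u' \<noteq> v"
        by (metis card_le_Suc0_iff_eq G.pair_finite_verts not_less_eq_eq numeral_2_eq_2 v)
      \<comment> \<open>Seen from another copy, \<open>Inr (v, x)\<close> is reached through its
        hub; reversing the geodesic gives the required direction.\<close>
      have "Inl v \<in> geodesic_interval (corona G H) (Inr (u', h)) (Inr (v, x))"
        by (rule hub_in_geodesic_interval) (use u' h v xV in \<open>auto simp: pverts_corona\<close>)
      then have "Inl v \<in> geodesic_interval (corona G H) (Inr (v, x)) (Inr (u', h))"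
        using C.geodesic_interval_commute[of "Inr (u', h)" "Inr (v, x)"] u' h v xV
        by (simp add: pverts_corona)
      moreover have "Inr (u', h) \<in> ?S" using u' h by auto
      ultimately show ?thesis
        using \<open>u = v\<close> by (auto simp: res_def strongly_resolves_def)
    next
      case False
      \<comment> \<open>Here \<open>G\<close> is a single vertex. Any non-neighbour \<open>z\<close>
        of \<open>x\<close> is outside the clique \<open>D\<close>, and the hub is the middle vertex
        between them.\<close>
      then obtain z where z: "z \<in> pverts H" "z \<noteq> x" "(x, z) \<notin> parcs H"
        using nonuniv xV by blast
      then have "z \<notin> D" using D x by (auto simp: twin_free_clique_def clique_def)
      then have "Inr (v, z) \<in> ?S" using v z by auto
      moreover have "Inl v \<in> geodesic_interval (corona G H) (Inr (v, x)) (Inr (v, z))"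
        using arc(1) z v by (intro C.middle_in_geodesic_interval) (auto simp: parcs_corona)
      ultimately show ?thesis
        using \<open>u = v\<close> by (auto simp: res_def strongly_resolves_def)
    qed
  qed
  have res_copy: "res (Inr (v, x)) (Inr (v, y))" if xy: "x \<in> D" "y \<in> D" "x \<noteq> y" for x y
  proof -
    \<comment> \<open>A vertex \<open>z\<close> adjacent to \<open>q\<close> but not to
      \<open>p\<close> makes \<open>q\<close> a middle vertex between \<open>p\<close> and
      \<open>z\<close>; being non-adjacent to \<open>p\<close>, it lies outside
      \<open>D\<close>.\<close>
    have *: "res (Inr (v, p)) (Inr (v, q))"
      if pq: "p \<in> D" "q \<in> D" "(p, q) \<in> parcs H" and z: "z \<in> pverts H - {p, q}"
        "(q, z) \<in> parcs H" "(p, z) \<notin> parcs H" for p q z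
    proof -
      have "z \<notin> D" using D z pq by (auto simp: twin_free_clique_def clique_def)
      then have "Inr (v, z) \<in> ?S" using v z by auto
      moreover have "Inr (v, q) \<in> geodesic_interval (corona G H) (Inr (v, p)) (Inr (v, z))"
        using z v pq by (intro C.middle_in_geodesic_interval) (auto simp: parcs_corona)
      ultimately show ?thesis by (auto simp: res_def strongly_resolves_def)
    qed
    have arc: "(x, y) \<in> parcs H" "(y, x) \<in> parcs H" "\<not> true_twins H x y"
      using D xy by (auto simp: twin_free_clique_def clique_def)
    then obtain z where z: "z \<in> pverts H - {x, y}" "(x, z) \<in> parcs H \<longleftrightarrow> (y, z) \<notin> parcs H"
      using H.true_twins_iff[of x y] xy DV by blast
    show ?thesis
    proof (cases "(x, z) \<in> parcs H")
      case True
      then have "res (Inr (v, y)) (Inr (v, x))"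
        by (intro *[OF xy(2,1) arc(2)]) (use z in auto)
      then show ?thesis by (rule res_sym)
    next
      case False
      then show ?thesis by (intro *[OF xy(1,2) arc(1)]) (use z in auto)
    qed
  qed
  have split: "s \<in> ?S \<or> (\<exists>u \<in> pverts G. s = Inl u) \<or> (\<exists>x \<in> D. s = Inr (v, x))"
    if "s \<in> pverts (corona G H)" for s
  proof (cases s)
    case (Inl u)
    with that show ?thesis by (auto simp: pverts_corona)
  next
    case (Inr p)
    with that show ?thesis by (cases p) (auto simp: pverts_corona)
  qed
  have "res s t" if st: "s \<in> pverts (corona G H)" "t \<in> pverts (corona G H)" "s \<noteq> t" for s t
  proof -
    have "res s t" if "s \<in> ?S \<or> t \<in> ?S"
      using that C.strongly_resolves_self[OF st(1,2)] corona_reachable st unfolding res_def by metis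
    \<comment> \<open>At least one of two distinct hubs differs from \<open>Inl v\<close>, and
      \<open>res_hub\<close> applies to that one.\<close>
    moreover have "res (Inl a) (Inl b)" if "a \<in> pverts G" "b \<in> pverts G" "a \<noteq> b" for a b
      using res_hub[of a "Inl b"] res_hub[of b "Inl a"] res_sym that by (auto simp: pverts_corona)
    ultimately show ?thesis
      using split[OF st(1)] split[OF st(2)] st(3) res_hub_copy res_copy res_sym by metis
  qed
  moreover have "?S \<subseteq> pverts (corona G H)" by (auto simp: pverts_corona)
  ultimately show ?thesis by (auto simp: strong_resolving_set_def res_def)
qed

text \<open>The additive form avoids truncated subtraction and transfers directly to the
  integers.\<close>

lemma strong_metric_dim_corona:
  assumes "2 \<le> card (pverts G) \<or> (\<forall>x \<in> pverts H. \<exists>z \<in> pverts H - {x}. (x, z) \<notin> parcs H)"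
  shows "strong_metric_dim (corona G H) + twin_free_clique_number H = card (pverts G) * card (pverts H)"
proof -
  obtain v where v: "v \<in> pverts G"
    using G_connected by (auto simp: connected_def strongly_connected_def)
  obtain D where D: "twin_free_clique H D" "card D = twin_free_clique_number H"
    using twin_free_clique_number_attained[OF H.pair_finite_verts] .
  have sub: "{v} \<times> D \<subseteq> pverts G \<times> pverts H"
    using D(1) v by (auto simp: twin_free_clique_def clique_def)
  have finGH: "finite (pverts G \<times> pverts H)"
    using G.pair_finite_verts H.pair_finite_verts by simp
  have le: "twin_free_clique_number H \<le> card (pverts G) * card (pverts H)"
    using card_mono[OF finGH sub] D(2) by (simp add: card_cartesian_product)
  have "strong_metric_dim (corona G H) = card (pverts G) * card (pverts H) - twin_free_clique_number H"
  proof (rule strong_metric_dim_eqI[OF C.pair_finite_verts strong_resolving_set_corona[OF assms v D(1)]])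
    show "card (Inr ` (pverts G \<times> pverts H - {v} \<times> D) :: ('a + 'a \<times> 'b) set)
        = card (pverts G) * card (pverts H) - twin_free_clique_number H"
      using D(2) card_Diff_subset[OF finite_subset[OF sub finGH] sub]
      by (simp add: card_image card_cartesian_product)
  qed (use strong_resolving_set_corona_card in force)
  with le show ?thesis by simp
qed

end

text \<open>Integers matter for \<open>n2 = 1\<close>: truncated subtraction would admit
  \<open>\<Delta> = 0\<close> in the second part, where the formula fails for two single
  vertices.\<close>

theorem theorem7:
  fixes G :: "'a pair_pre_digraph" and H :: "'b pair_pre_digraph"
    and n1 n2 \<Delta> :: nat
  assumes "pair_graph G" and "Digraph_Component.connected (with_proj G)"
    and "card (pverts G) = n1"
    and "pair_graph H" and "pverts H \<noteq> {}"
    and "card (pverts H) = n2" and "max_degree H = \<Delta>"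
  shows "(int \<Delta> = int n2 - 1 \<longrightarrow>
            int (strong_metric_dim (graph_join K1 H))
              = int n2 + 1 - int (twin_free_clique_number H)) \<and>
         (int \<Delta> \<le> int n2 - 2 \<or> n1 \<ge> 2 \<longrightarrow>
            int (strong_metric_dim (corona G H))
              = int n1 * int n2 - int (twin_free_clique_number H))"
proof (intro conjI impI)
  interpret H: pair_graph H by fact
  interpret J: pair_graph "graph_join K1 H" by (rule pair_graph_join[OF pair_graph_K1]) fact
  assume \<Delta>: "int \<Delta> = int n2 - 1"
  have "\<Delta> \<in> out_degree H ` pverts H"
    using assms(5,7) H.pair_finite_verts unfolding max_degree_def by (metis Max_in finite_imageI image_is_empty)
  then obtain u where u: "u \<in> pverts H" "out_degree H u = \<Delta>" by blast
  then have "\<forall>w \<in> pverts H - {u}. (u, w) \<in> parcs H"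
    using H.out_degree_universal[OF u(1)] \<Delta> assms(6) by linarith
  then have num: "twin_free_clique_number (graph_join K1 H) = twin_free_clique_number H"
    using twin_free_clique_number_join_K1[OF assms(4) u(1)] by blast
  obtain D where "twin_free_clique H D" "card D = twin_free_clique_number H"
    using twin_free_clique_number_attained[OF H.pair_finite_verts] .
  \<comment> \<open>This bound makes the natural subtraction agree with the integer one.\<close>
  then have "twin_free_clique_number H \<le> n2"
    using card_mono[OF H.pair_finite_verts] assms(6) by (metis twin_free_clique_def clique_def)
  moreover have "card (pverts (graph_join K1 H)) = Suc n2"
    using assms(6) H.pair_finite_verts by (simp add: pverts_join_K1 card_image card_insert_if image_iff)
  ultimately show "int (strong_metric_dim (graph_join K1 H))
      = int n2 + 1 - int (twin_free_clique_number H)"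
    using J.strong_metric_dim_diameter_two[OF diameter_join_K1] num by simp
next
  interpret connected_corona G H
    using assms(1,2,4,5) by (simp add: connected_corona_def connected_corona_axioms_def)
  assume "int \<Delta> \<le> int n2 - 2 \<or> n1 \<ge> 2"
  \<comment> \<open>A vertex without non-neighbours would have degree \<open>n2 - 1\<close>,
    exceeding \<open>\<Delta>\<close>.\<close>
  moreover have "\<exists>z \<in> pverts H - {x}. (x, z) \<notin> parcs H"
    if "int \<Delta> \<le> int n2 - 2" "x \<in> pverts H" for x
  proof -
    have "out_degree H x \<le> \<Delta>"
      using that(2) assms(7) H.pair_finite_verts by (auto simp: max_degree_def)
    then show ?thesis
      using H.out_degree_universal[OF that(2)] that(1) assms(6) by auto
  qed
  ultimately have "strong_metric_dim (corona G H) + twin_free_clique_number H = n1 * n2"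
    using strong_metric_dim_corona assms(3,6) by blast
  then show "int (strong_metric_dim (corona G H))
      = int n1 * int n2 - int (twin_free_clique_number H)"
    by (metis add_diff_cancel_right' of_nat_add of_nat_mult)
qed

end
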